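(* $(\mathbb{Q}[\mu]\langle Y\rangle,\ast_\mu)$ is a commutative and associative $\mathbb{Q}[\mu]$-algebra with unit $1$.
   Context: Fix $\mu\in\mathbb{C}$ with $\mathrm{Re}(\mu)>0$; $\mathbb{Q}[\mu]\subset\mathbb{C}$ the ring generated by $\mu$. $Y=\{y_{k,m}:k\in\mathbb{N},m\in\mathbb{Q}_{>0}\}$; $\mathbb{Q}[\mu]\langle Y\rangle$ is the free $\mathbb{Q}[\mu]$-module on all words over $Y$ (empty word $1$), with concatenation. On the span of letters define the bilinear product $\odot$: $y_{k_1,m}\odot y_{k_2,m}=y_{k_1+k_2,m}$, and for $m_1\ne m_2$, $y_{k_1,m_1}\odot y_{k_2,m_2}=\sum_{i=1}^{k_1}a_iy_{i,m_1}+\sum_{j=1}^{k_2}b_jy_{j,m_2}$ with $\frac{1}{(x+m_1)^{k_1}(x+m_2)^{k_2}}=\sum_{i}\frac{a_i}{(x+m_1)^i}+\sum_j\frac{b_j}{(x+m_2)^j}$. The $\mu$-stuffle product $\ast_\mu$ is the $\mathbb{Q}[\mu]$-bilinear map on $\mathbb{Q}[\mu]\langle Y\rangle$ defined recursively by $1\ast_\mu w=w\ast_\mu1=w$ for all words $w$ and $ux\ast_\mu vy=(u\ast_\mu vy)x+(ux\ast_\mu v)y-\mu\,(u\ast_\mu v)(x\odot y)$ for letters $x,y\in Y$ and words $u,v$ (concatenation extended bilinearly). *)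

theory Defs
  imports
    Complex_Main
    "HOL-Algebra.Module"
    "HOL-Library.Poly_Mapping"
    "HOL-Computational_Algebra.Polynomial"
begin

type_synonym letter = "nat \<times> rat"
type_synonym word = "letter list"

text \<open>The pair \<open>(k, m)\<close> stands for $y_{k,m}$. Here $\mathbb{N}$ starts at $1$: for $k_1 = k_2 = 0$ the
  partial fraction decomposition below would not exist.\<close>

definition Y :: "letter set" where
  "Y = {(k, m). 1 \<le> k \<and> 0 < m}"

definition Qmu :: "complex \<Rightarrow> complex set" where
  "Qmu \<mu> = {poly p \<mu> | p. \<forall>i. coeff p i \<in> \<rat>}"

definition Qmu_ring :: "complex \<Rightarrow> complex ring" where
  "Qmu_ring \<mu> = \<lparr>carrier = Qmu \<mu>, monoid.mult = (*), one = 1, zero = 0, add = (+)\<rparr>"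

text \<open>Products are defined on finitely supported complex combinations of arbitrary lists;
  the free module $\mathbb{Q}[\mu]\langle Y\rangle$ is the following subset.\<close>

definition QmuY :: "complex \<Rightarrow> (word \<Rightarrow>\<^sub>0 complex) set" where
  "QmuY \<mu> = {p. Poly_Mapping.keys p \<subseteq> lists Y \<and> (\<forall>w. Poly_Mapping.lookup p w \<in> Qmu \<mu>)}"

definition scale :: "complex \<Rightarrow> (word \<Rightarrow>\<^sub>0 complex) \<Rightarrow> (word \<Rightarrow>\<^sub>0 complex)" where
  "scale c p = Poly_Mapping.map ((*) c) p"

definition word_elem :: "word \<Rightarrow> (word \<Rightarrow>\<^sub>0 complex)" where
  "word_elem w = Poly_Mapping.single w 1"

definition bilinear_ext ::
  "(word \<Rightarrow> word \<Rightarrow> (word \<Rightarrow>\<^sub>0 complex)) \<Rightarrow>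
   (word \<Rightarrow>\<^sub>0 complex) \<Rightarrow> (word \<Rightarrow>\<^sub>0 complex) \<Rightarrow> (word \<Rightarrow>\<^sub>0 complex)" where
  "bilinear_ext f p q =
     (\<Sum>u\<in>Poly_Mapping.keys p. \<Sum>v\<in>Poly_Mapping.keys q.
        scale (Poly_Mapping.lookup p u * Poly_Mapping.lookup q v) (f u v))"

definition conc ::
  "(word \<Rightarrow>\<^sub>0 complex) \<Rightarrow> (word \<Rightarrow>\<^sub>0 complex) \<Rightarrow> (word \<Rightarrow>\<^sub>0 complex)" where
  "conc = bilinear_ext (\<lambda>u v. word_elem (u @ v))"

text \<open>Coefficients are required to vanish outside the summation range so that the pair is unique.
  An identity of rational functions over $\mathbb{Q}$ is the same as equality at all rational points
  other than the poles.\<close>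

definition is_partial_fraction ::
  "nat \<Rightarrow> rat \<Rightarrow> nat \<Rightarrow> rat \<Rightarrow> (nat \<Rightarrow> rat) \<Rightarrow> (nat \<Rightarrow> rat) \<Rightarrow> bool" where
  "is_partial_fraction k1 m1 k2 m2 a b \<longleftrightarrow>
     (\<forall>i. i \<notin> {1..k1} \<longrightarrow> a i = 0) \<and>
     (\<forall>j. j \<notin> {1..k2} \<longrightarrow> b j = 0) \<and>
     (\<forall>x. x \<noteq> - m1 \<and> x \<noteq> - m2 \<longrightarrow>
        1 / ((x + m1) ^ k1 * (x + m2) ^ k2) =
        (\<Sum>i=1..k1. a i / (x + m1) ^ i) + (\<Sum>j=1..k2. b j / (x + m2) ^ j))"

definition partial_fraction ::
  "nat \<Rightarrow> rat \<Rightarrow> nat \<Rightarrow> rat \<Rightarrow> (nat \<Rightarrow> rat) \<times> (nat \<Rightarrow> rat)" where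
  "partial_fraction k1 m1 k2 m2 = (THE (a, b). is_partial_fraction k1 m1 k2 m2 a b)"

text \<open>The product $\odot$ of two letters, a linear combination of one-letter words.\<close>

fun letter_prod :: "letter \<Rightarrow> letter \<Rightarrow> (word \<Rightarrow>\<^sub>0 complex)" where
  "letter_prod (k1, m1) (k2, m2) =
     (if m1 = m2 then word_elem [(k1 + k2, m1)]
      else let (a, b) = partial_fraction k1 m1 k2 m2 in
        (\<Sum>i=1..k1. scale (of_rat (a i)) (word_elem [(i, m1)])) +
        (\<Sum>j=1..k2. scale (of_rat (b j)) (word_elem [(j, m2)])))"

function stuffle_word :: "complex \<Rightarrow> word \<Rightarrow> word \<Rightarrow> (word \<Rightarrow>\<^sub>0 complex)" where
  "stuffle_word \<mu> [] w = word_elem w"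
| "stuffle_word \<mu> (u @ [x]) [] = word_elem (u @ [x])"
| "stuffle_word \<mu> (u @ [x]) (v @ [y]) =
     conc (stuffle_word \<mu> u (v @ [y])) (word_elem [x]) +
     conc (stuffle_word \<mu> (u @ [x]) v) (word_elem [y]) -
     scale \<mu> (conc (stuffle_word \<mu> u v) (letter_prod x y))"
  by (metis prod_cases3 rev_exhaust) simp_all
termination
  by (relation "measure (\<lambda>(\<mu>, u, v). length u + length v)") auto

definition stuffle ::
  "complex \<Rightarrow> (word \<Rightarrow>\<^sub>0 complex) \<Rightarrow> (word \<Rightarrow>\<^sub>0 complex) \<Rightarrow> (word \<Rightarrow>\<^sub>0 complex)" where
  "stuffle \<mu> = bilinear_ext (stuffle_word \<mu>)"

definition stuffle_algebra :: "complex \<Rightarrow> (complex, word \<Rightarrow>\<^sub>0 complex) module" where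
  "stuffle_algebra \<mu> =
     \<lparr>carrier = QmuY \<mu>, monoid.mult = stuffle \<mu>, one = word_elem [], zero = 0, add = (+),
      module.smult = scale\<rparr>"

end

theory Submission
  imports Defs
begin

text \<open>Sending the letter \<open>y\<^sub>k\<^sub>,\<^sub>m\<close> to the function \<open>1 / (x + m)\<^sup>k\<close> turns \<open>\<odot>\<close> into the pointwise
  product, and these functions are linearly independent; hence \<open>\<odot>\<close> is commutative and associative.
  Commutativity of the stuffle product follows by induction along its recursion. In a commutative
  algebra associativity amounts to the symmetry \<open>(p \<ast> q) \<ast> r = (r \<ast> q) \<ast> p\<close>, which needs only one
  expansion: applying the recursion twice to \<open>(pa \<ast> qb) \<ast> rc\<close> with \<open>a\<close>, \<open>b\<close>, \<open>c\<close> in the span of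
  the letters gives one term for each nonempty subset of \<open>{a, b, c}\<close>, and exchanging \<open>pa\<close> and \<open>rc\<close>
  permutes these terms, by induction on the total length.\<close>

section \<open>Bilinear maps\<close>

locale bilinear_map =
  vs1: vector_space s1 + vs2: vector_space s2 + vs3: vector_space s3
  for s1 :: "'k::field \<Rightarrow> 'a::ab_group_add \<Rightarrow> 'a"
    and s2 :: "'k \<Rightarrow> 'b::ab_group_add \<Rightarrow> 'b"
    and s3 :: "'k \<Rightarrow> 'c::ab_group_add \<Rightarrow> 'c" +
  fixes f :: "'a \<Rightarrow> 'b \<Rightarrow> 'c"
  assumes linear_left: "Vector_Spaces.linear s1 s3 (\<lambda>x. f x y)"
    and linear_right: "Vector_Spaces.linear s2 s3 (f x)"
begin

sublocale left: Vector_Spaces.linear s1 s3 "\<lambda>x. f x y" for y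
  by (rule linear_left)

lemmas linear_compose_left = Vector_Spaces.linear_compose[OF _ linear_left, unfolded comp_def]

lemmas linear_compose_right = Vector_Spaces.linear_compose[OF _ linear_right, unfolded comp_def]

lemma eq_on_span:
  assumes "bilinear_map s1 s2 s3 g"
    and x: "x \<in> vs1.span B" and y: "y \<in> vs2.span C"
    and eq: "\<And>b c. b \<in> B \<Longrightarrow> c \<in> C \<Longrightarrow> f b c = g b c"
  shows "f x y = g x y"
proof -
  interpret g: bilinear_map s1 s2 s3 g
    by fact
  interpret vs13: vector_space_pair s1 s3 ..
  interpret vs23: vector_space_pair s2 s3 ..
  have "f b y = g b y" if "b \<in> B" for b
    using linear_right g.linear_right y eq[OF that] by (rule vs23.linear_eq_on)
  with linear_left g.linear_left x show ?thesis
    by (rule vs13.linear_eq_on)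
qed

end

lemma bilinear_mapI:
  assumes "\<And>y. Vector_Spaces.linear s1 s3 (\<lambda>x. f x y)"
    and "\<And>x. Vector_Spaces.linear s2 s3 (f x)"
  shows "bilinear_map s1 s2 s3 f"
  using assms by (auto simp: bilinear_map_def bilinear_map_axioms_def Vector_Spaces.linear_def)

section \<open>Linear combinations of words\<close>

lemma lookup_scale [simp]: "Poly_Mapping.lookup (scale c p) w = c * Poly_Mapping.lookup p w"
  by (simp add: scale_def map.rep_eq when_def)

lemma keys_scale_subset: "Poly_Mapping.keys (scale c p) \<subseteq> Poly_Mapping.keys p"
  by (auto simp: in_keys_iff)

global_interpretation words: vector_space scale
  by unfold_locales (auto intro!: poly_mapping_eqI simp: lookup_add algebra_simps)

global_interpretation words_pair: vector_space_pair scale scale ..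

lemma linear_sum_keys:
  assumes "vector_space s"
  shows "Vector_Spaces.linear scale s
    (\<lambda>p. \<Sum>w\<in>Poly_Mapping.keys p. s (Poly_Mapping.lookup p w) (g w))"
proof -
  interpret target: vector_space s
    by fact
  let ?f = "\<lambda>p. \<Sum>w\<in>Poly_Mapping.keys p. s (Poly_Mapping.lookup p w) (g w)"
  have "?f (p + q) = ?f p + ?f q" for p q
    by (rule setsum_keys_plus_distrib) (simp_all add: target.scale_left_distrib)
  moreover have "?f (scale c p) = s c (?f p)" for c p
  proof -
    have "?f (scale c p) = (\<Sum>w\<in>Poly_Mapping.keys p. s (c * Poly_Mapping.lookup p w) (g w))"
      by (rule sum.mono_neutral_cong_left) (auto simp: in_keys_iff)
    then show ?thesis
      by (simp add: target.scale_sum_right)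
  qed
  ultimately show ?thesis
    using words.vector_space_axioms assms unfolding Vector_Spaces.linear_iff by blast
qed

lemma sum_scale_word_elem:
  "(\<Sum>w\<in>Poly_Mapping.keys p. scale (Poly_Mapping.lookup p w) (word_elem w)) = p"
proof (rule poly_mapping_eqI)
  fix v
  have "Poly_Mapping.lookup (scale (Poly_Mapping.lookup p w) (word_elem w)) v =
      (if w = v then Poly_Mapping.lookup p v else 0)" for w
    by (simp add: word_elem_def lookup_single)
  then show "Poly_Mapping.lookup
      (\<Sum>w\<in>Poly_Mapping.keys p. scale (Poly_Mapping.lookup p w) (word_elem w)) v =
      Poly_Mapping.lookup p v"
    by (simp add: lookup_sum in_keys_iff)
qed

lemma span_word_elem: "words.span (word_elem ` A) = {p. Poly_Mapping.keys p \<subseteq> A}"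
proof
  have "words.subspace {p. Poly_Mapping.keys p \<subseteq> A}"
  proof (rule words.subspaceI)
    show "p + q \<in> {p. Poly_Mapping.keys p \<subseteq> A}"
      if "p \<in> {p. Poly_Mapping.keys p \<subseteq> A}" "q \<in> {p. Poly_Mapping.keys p \<subseteq> A}" for p q
      using that keys_add[of p q] by blast
    show "scale c p \<in> {p. Poly_Mapping.keys p \<subseteq> A}"
      if "p \<in> {p. Poly_Mapping.keys p \<subseteq> A}" for c p
      using that keys_scale_subset[of c p] by blast
  qed simp
  then show "words.span (word_elem ` A) \<subseteq> {p. Poly_Mapping.keys p \<subseteq> A}"
    by (intro words.span_minimal) (auto simp: word_elem_def)
next
  have "p \<in> words.span (word_elem ` A)" if "Poly_Mapping.keys p \<subseteq> A" for p
  proof -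
    have "(\<Sum>w\<in>Poly_Mapping.keys p. scale (Poly_Mapping.lookup p w) (word_elem w))
        \<in> words.span (word_elem ` A)"
      using that by (intro words.span_sum words.span_scale words.span_base) blast
    then show ?thesis
      by (simp only: sum_scale_word_elem)
  qed
  then show "{p. Poly_Mapping.keys p \<subseteq> A} \<subseteq> words.span (word_elem ` A)"
    by blast
qed

lemma bilinear_ext_eq_sum_left:
  "bilinear_ext f p q = (\<Sum>u\<in>Poly_Mapping.keys p. scale (Poly_Mapping.lookup p u)
     (\<Sum>v\<in>Poly_Mapping.keys q. scale (Poly_Mapping.lookup q v) (f u v)))"
  by (simp add: bilinear_ext_def words.scale_sum_right)

lemma bilinear_ext_eq_sum_right:
  "bilinear_ext f p q = (\<Sum>v\<in>Poly_Mapping.keys q. scale (Poly_Mapping.lookup q v)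
     (\<Sum>u\<in>Poly_Mapping.keys p. scale (Poly_Mapping.lookup p u) (f u v)))"
  unfolding bilinear_ext_def
  by (subst sum.swap) (simp add: words.scale_sum_right mult.commute)

lemma bilinear_map_bilinear_ext: "bilinear_map scale scale scale (bilinear_ext f)"
proof (rule bilinear_mapI)
  show "Vector_Spaces.linear scale scale (\<lambda>p. bilinear_ext f p q)" for q
    unfolding bilinear_ext_eq_sum_left
    by (rule linear_sum_keys) (rule words.vector_space_axioms)
  show "Vector_Spaces.linear scale scale (bilinear_ext f p)" for p
    unfolding bilinear_ext_eq_sum_right
    by (rule linear_sum_keys) (rule words.vector_space_axioms)
qed

lemma bilinear_ext_word_elem [simp]: "bilinear_ext f (word_elem u) (word_elem v) = f u v"
  by (simp add: bilinear_ext_def word_elem_def)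

definition letter_mult :: "(word \<Rightarrow>\<^sub>0 complex) \<Rightarrow> (word \<Rightarrow>\<^sub>0 complex) \<Rightarrow> (word \<Rightarrow>\<^sub>0 complex)" where
  "letter_mult = bilinear_ext (\<lambda>u v. letter_prod (hd u) (hd v))"

global_interpretation conc: bilinear_map scale scale scale conc
  unfolding conc_def by (rule bilinear_map_bilinear_ext)

global_interpretation letter_mult: bilinear_map scale scale scale letter_mult
  unfolding letter_mult_def by (rule bilinear_map_bilinear_ext)

global_interpretation stuffle: bilinear_map scale scale scale "stuffle \<mu>" for \<mu>
  unfolding stuffle_def by (rule bilinear_map_bilinear_ext)

lemma conc_word_elem [simp]: "conc (word_elem u) (word_elem v) = word_elem (u @ v)"
  by (simp add: conc_def)

lemma letter_mult_word_elem [simp]: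
  "letter_mult (word_elem [x]) (word_elem [y]) = letter_prod x y"
  by (simp add: letter_mult_def)

lemma stuffle_word_elem [simp]: "stuffle \<mu> (word_elem u) (word_elem v) = stuffle_word \<mu> u v"
  by (simp add: stuffle_def)

lemmas linear_intros =
  words.linear_ident words_pair.linear_compose_add words_pair.linear_compose_sub
  words_pair.linear_compose_scale_right
  conc.linear_compose_left conc.linear_compose_right
  letter_mult.linear_compose_left letter_mult.linear_compose_right
  stuffle.linear_compose_left stuffle.linear_compose_right

section \<open>Partial fractions\<close>

definition cleared_inverse_power :: "'a::field set \<Rightarrow> nat \<Rightarrow> 'a \<Rightarrow> nat \<Rightarrow> 'a poly" where
  "cleared_inverse_power A n a k = [:- a, 1:] ^ (n - k) * (\<Prod>b\<in>A - {a}. [:- b, 1:] ^ n)"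

lemma poly_cleared_inverse_power:
  assumes "finite A" "a \<in> A" "k \<le> n" "x \<noteq> a"
  shows "poly (cleared_inverse_power A n a k) x = (\<Prod>b\<in>A. (x - b) ^ n) / (x - a) ^ k"
  using assms
  by (simp add: cleared_inverse_power_def poly_prod prod.remove[of A a] power_diff[of "x - a"])

lemma poly_cleared_inverse_power_eq_0_iff:
  assumes "finite A" "d \<in> A" "0 < k" "k \<le> n"
  shows "poly (cleared_inverse_power A n a k) d = 0 \<longleftrightarrow> d \<noteq> a \<or> k < n"
  using assms by (auto simp: cleared_inverse_power_def poly_prod)

text \<open>Clear denominators by the \<open>n\<close>-th power of every \<open>x - a i\<close>, where \<open>n\<close> is the largest exponent
  with a nonzero coefficient, attained at \<open>j\<close>. At \<open>x = a j\<close> only the \<open>j\<close>-th term survives.\<close>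

lemma inverse_powers_independent:
  fixes a c :: "'i \<Rightarrow> 'a::field" and k :: "'i \<Rightarrow> nat"
  assumes "finite I" "infinite X"
    and inj: "inj_on (\<lambda>i. (k i, a i)) I"
    and pos: "\<And>i. i \<in> I \<Longrightarrow> 0 < k i"
    and zero: "\<And>x. x \<in> X \<Longrightarrow> (\<Sum>i\<in>I. c i / (x - a i) ^ k i) = 0"
    and "i \<in> I"
  shows "c i = 0"
proof (rule ccontr)
  assume "c i \<noteq> 0"
  define J where "J = {i \<in> I. c i \<noteq> 0}"
  have J: "finite J" "J \<noteq> {}"
    using \<open>finite I\<close> \<open>i \<in> I\<close> \<open>c i \<noteq> 0\<close> by (auto simp: J_def)
  define n where "n = Max (k ` J)"
  have "n \<in> k ` J"
    unfolding n_def using J by (intro Max_in) simp_all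
  then obtain j where j: "j \<in> J" "k j = n"
    by blast
  have k_le: "k i \<le> n" if "i \<in> J" for i
    using J that by (simp add: n_def)
  define Q where "Q i = cleared_inverse_power (a ` J) n (a i) (k i)" for i
  define P where "P = (\<Sum>i\<in>J. smult (c i) (Q i))"
  have "poly P x = 0" if x: "x \<in> X - a ` J" for x
  proof -
    have "poly (Q i) x = (\<Prod>b\<in>a ` J. (x - b) ^ n) / (x - a i) ^ k i" if "i \<in> J" for i
      unfolding Q_def using that x J k_le by (intro poly_cleared_inverse_power) auto
    then have "poly P x = (\<Prod>b\<in>a ` J. (x - b) ^ n) * (\<Sum>i\<in>J. c i / (x - a i) ^ k i)"
      by (simp add: P_def poly_sum sum_distrib_left mult.commute)
    also have "(\<Sum>i\<in>J. c i / (x - a i) ^ k i) = (\<Sum>i\<in>I. c i / (x - a i) ^ k i)"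
      by (rule sum.mono_neutral_left) (use \<open>finite I\<close> in \<open>auto simp: J_def\<close>)
    finally show ?thesis
      using zero x by simp
  qed
  then have "X - a ` J \<subseteq> {x. poly P x = 0}"
    by blast
  moreover have "infinite (X - a ` J)"
    using \<open>infinite X\<close> J by simp
  ultimately have "P = 0"
    using poly_roots_finite[of P] finite_subset by blast
  have Q_eq_0_iff: "poly (Q i) (a j) = 0 \<longleftrightarrow> i \<noteq> j" if "i \<in> J" for i
  proof -
    have "poly (Q i) (a j) = 0 \<longleftrightarrow> a j \<noteq> a i \<or> k i < n"
      unfolding Q_def using that j J k_le pos
      by (intro poly_cleared_inverse_power_eq_0_iff) (auto simp: J_def)
    also have "\<dots> \<longleftrightarrow> i \<noteq> j"
      using that j inj k_le[OF that] by (auto simp: J_def inj_on_def less_le)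
    finally show ?thesis .
  qed
  then have "(\<Sum>i\<in>J - {j}. c i * poly (Q i) (a j)) = 0"
    by (intro sum.neutral) simp
  then have "poly P (a j) = c j * poly (Q j) (a j)"
    using J j by (simp add: P_def poly_sum sum.remove[of J j])
  with \<open>P = 0\<close> j Q_eq_0_iff[of j] show False
    by (simp add: J_def)
qed

lemma is_partial_fraction_unique:
  assumes "m1 \<noteq> m2"
    and "is_partial_fraction k1 m1 k2 m2 a b" "is_partial_fraction k1 m1 k2 m2 a' b'"
  shows "a = a' \<and> b = b'"
proof -
  let ?I = "{1..k1} <+> {1..k2}"
  let ?c = "case_sum (\<lambda>i. a i - a' i) (\<lambda>j. b j - b' j)"
  have coeff_eq: "?c i = 0" if "i \<in> ?I" for i
  proof (rule inverse_powers_independent[where k = "case_sum id id"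
        and a = "case_sum (\<lambda>_. - m1) (\<lambda>_. - m2)" and X = "UNIV - {- m1, - m2}"])
    fix x assume "x \<in> UNIV - {- m1, - m2}"
    then have "(\<Sum>i=1..k1. a i / (x + m1) ^ i) + (\<Sum>j=1..k2. b j / (x + m2) ^ j) =
        (\<Sum>i=1..k1. a' i / (x + m1) ^ i) + (\<Sum>j=1..k2. b' j / (x + m2) ^ j)"
      using assms(2,3) by (simp add: is_partial_fraction_def)
    then show "(\<Sum>i\<in>?I. ?c i / (x - case_sum (\<lambda>_. - m1) (\<lambda>_. - m2) i) ^ case_sum id id i) = 0"
      by (simp add: sum.Plus diff_divide_distrib sum_subtractf)
  qed (use \<open>m1 \<noteq> m2\<close> that in \<open>auto simp: infinite_UNIV_char_0 inj_on_def\<close>)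
  have "a i = a' i" for i
    using coeff_eq[OF InlI, of i] assms(2,3)
    by (cases "i \<in> {1..k1}") (auto simp: is_partial_fraction_def)
  moreover have "b j = b' j" for j
    using coeff_eq[OF InrI, of j] assms(2,3)
    by (cases "j \<in> {1..k2}") (auto simp: is_partial_fraction_def)
  ultimately show ?thesis
    by blast
qed

lemma is_partial_fraction_commute:
  "is_partial_fraction k1 m1 k2 m2 a b \<longleftrightarrow> is_partial_fraction k2 m2 k1 m1 b a"
  by (auto simp: is_partial_fraction_def add.commute mult.commute)

lemma is_partial_fraction_0_left:
  assumes "0 < k"
  shows "is_partial_fraction 0 m1 k m2 (\<lambda>_. 0) (\<lambda>j. of_bool (j = k))"
  using assms
  by (auto simp: is_partial_fraction_def of_bool_def if_distrib[of "\<lambda>z. z / _"] cong: if_cong)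

lemma is_partial_fraction_Suc_Suc:
  assumes "m1 \<noteq> m2"
    and "is_partial_fraction (Suc k1) m1 k2 m2 a b" "is_partial_fraction k1 m1 (Suc k2) m2 a' b'"
  shows "is_partial_fraction (Suc k1) m1 (Suc k2) m2
    (\<lambda>i. (a i - a' i) / (m2 - m1)) (\<lambda>j. (b j - b' j) / (m2 - m1))"
proof -
  have "1 / ((x + m1) ^ Suc k1 * (x + m2) ^ Suc k2) =
      (\<Sum>i=1..Suc k1. (a i - a' i) / (m2 - m1) / (x + m1) ^ i) +
      (\<Sum>j=1..Suc k2. (b j - b' j) / (m2 - m1) / (x + m2) ^ j)"
    if x: "x \<noteq> - m1" "x \<noteq> - m2" for x
  proof -
    have "x + m1 \<noteq> 0" "x + m2 \<noteq> 0"
      using x by (simp_all add: add_eq_0_iff2)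
    then have "1 / ((x + m1) ^ Suc k1 * (x + m2) ^ Suc k2) =
        (1 / ((x + m1) ^ Suc k1 * (x + m2) ^ k2) - 1 / ((x + m1) ^ k1 * (x + m2) ^ Suc k2)) /
        (m2 - m1)"
      using \<open>m1 \<noteq> m2\<close> by (simp add: divide_simps)
    also have "1 / ((x + m1) ^ Suc k1 * (x + m2) ^ k2) =
        (\<Sum>i=1..Suc k1. a i / (x + m1) ^ i) + (\<Sum>j=1..Suc k2. b j / (x + m2) ^ j)"
      using assms(2) x by (simp add: is_partial_fraction_def)
    also have "1 / ((x + m1) ^ k1 * (x + m2) ^ Suc k2) =
        (\<Sum>i=1..Suc k1. a' i / (x + m1) ^ i) + (\<Sum>j=1..Suc k2. b' j / (x + m2) ^ j)"
      using assms(3) x by (simp add: is_partial_fraction_def)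
    finally show ?thesis
      by (simp only: diff_divide_distrib sum_subtractf sum_divide_distrib add_divide_distrib
          divide_divide_eq_left mult.commute)
  qed
  then show ?thesis
    using assms(2,3) by (auto simp: is_partial_fraction_def)
qed

lemma is_partial_fraction_exists:
  assumes "m1 \<noteq> m2" "0 < k1 + k2"
  shows "\<exists>a b. is_partial_fraction k1 m1 k2 m2 a b"
  using assms(2)
proof (induction "k1 + k2" arbitrary: k1 k2 rule: less_induct)
  case less
  consider "k1 = 0" "0 < k2" | "k2 = 0" "0 < k1"
    | l1 l2 where "k1 = Suc l1" "k2 = Suc l2"
    using less.prems by (metis add_is_0 gr0_implies_Suc gr0I)
  then show ?case
  proof cases
    case 1
    then show ?thesis
      using is_partial_fraction_0_left by blast
  next
    case 2
    then have "is_partial_fraction k1 m1 0 m2 (\<lambda>i. of_bool (i = k1)) (\<lambda>_. 0)"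
      using is_partial_fraction_0_left is_partial_fraction_commute by blast
    with 2 show ?thesis
      by blast
  next
    case 3
    obtain a b where "is_partial_fraction k1 m1 l2 m2 a b"
      using less.hyps[of k1 l2] 3 by auto
    moreover obtain a' b' where "is_partial_fraction l1 m1 k2 m2 a' b'"
      using less.hyps[of l1 k2] 3 by auto
    ultimately show ?thesis
      using is_partial_fraction_Suc_Suc[OF \<open>m1 \<noteq> m2\<close>] 3 by blast
  qed
qed

lemma is_partial_fraction_partial_fraction:
  assumes "m1 \<noteq> m2" "0 < k1 + k2"
  shows "case_prod (is_partial_fraction k1 m1 k2 m2) (partial_fraction k1 m1 k2 m2)"
  unfolding partial_fraction_def
proof (rule theI')
  obtain a b where "is_partial_fraction k1 m1 k2 m2 a b"
    using is_partial_fraction_exists[OF assms] by blast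
  then show "\<exists>!ab. case_prod (is_partial_fraction k1 m1 k2 m2) ab"
    using is_partial_fraction_unique[OF assms(1)] by (intro ex1I[of _ "(a, b)"]) auto
qed

section \<open>The product of letters\<close>

definition letter_span :: "(word \<Rightarrow>\<^sub>0 complex) set" where
  "letter_span = words.span (word_elem ` (\<lambda>y. [y]) ` Y)"

lemma word_elem_in_letter_span: "y \<in> Y \<Longrightarrow> word_elem [y] \<in> letter_span"
  unfolding letter_span_def by (blast intro: words.span_base)

lemma keys_letter_spanE:
  assumes "p \<in> letter_span" "w \<in> Poly_Mapping.keys p"
  obtains y where "w = [y]" "y \<in> Y"
  using assms unfolding letter_span_def span_word_elem by blast

lemma letter_prod_in_letter_span:
  assumes "x \<in> Y" "y \<in> Y"
  shows "letter_prod x y \<in> letter_span"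
proof -
  obtain k1 m1 k2 m2 where "x = (k1, m1)" "y = (k2, m2)"
    by (metis surj_pair)
  moreover have "word_elem [(k, m)] \<in> letter_span" if "1 \<le> k" "0 < m" for k m
    using that by (simp add: word_elem_in_letter_span Y_def)
  ultimately show ?thesis
    using assms unfolding letter_span_def
    by (auto simp: Y_def split: prod.split
        intro!: words.span_add words.span_sum words.span_scale)
qed

lemma letter_mult_in_letter_span:
  assumes "p \<in> letter_span" "q \<in> letter_span"
  shows "letter_mult p q \<in> letter_span"
proof -
  have "letter_prod (hd u) (hd v) \<in> letter_span"
    if u: "u \<in> Poly_Mapping.keys p" and v: "v \<in> Poly_Mapping.keys q" for u v
  proof -
    obtain x y where "u = [x]" "v = [y]" "x \<in> Y" "y \<in> Y"
      using keys_letter_spanE[OF assms(1) u] keys_letter_spanE[OF assms(2) v] by metis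
    then show ?thesis
      by (simp add: letter_prod_in_letter_span)
  qed
  then show ?thesis
    unfolding letter_mult_def bilinear_ext_def letter_span_def
    by (intro words.span_sum words.span_scale)
qed

definition letter_eval :: "rat \<Rightarrow> (word \<Rightarrow>\<^sub>0 complex) \<Rightarrow> complex" where
  "letter_eval x p = (\<Sum>w\<in>Poly_Mapping.keys p.
     Poly_Mapping.lookup p w * (1 / of_rat (x + snd (hd w)) ^ fst (hd w)))"

lemma linear_letter_eval: "Vector_Spaces.linear scale (*) (letter_eval x)"
  unfolding letter_eval_def by (rule linear_sum_keys) (unfold_locales, simp_all add: algebra_simps)

lemma module_hom_letter_eval: "module_hom scale (*) (letter_eval x)"
  using linear_letter_eval by (simp add: module_hom_iff_linear)

lemmas letter_eval_add = module_hom.add[OF module_hom_letter_eval]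
lemmas letter_eval_diff = module_hom.diff[OF module_hom_letter_eval]
lemmas letter_eval_scale = module_hom.scale[OF module_hom_letter_eval]
lemmas letter_eval_sum = module_hom.sum[OF module_hom_letter_eval]

lemma letter_eval_word_elem [simp]:
  "letter_eval x (word_elem [(k, m)]) = 1 / of_rat (x + m) ^ k"
  by (simp add: letter_eval_def word_elem_def)

lemma letter_eval_letter_prod:
  assumes "y \<in> Y" "z \<in> Y" "0 < x"
  shows "letter_eval x (letter_prod y z) =
    letter_eval x (word_elem [y]) * letter_eval x (word_elem [z])"
proof -
  obtain k1 m1 k2 m2 where yz: "y = (k1, m1)" "z = (k2, m2)"
    by (metis surj_pair)
  show ?thesis
  proof (cases "m1 = m2")
    case True
    then show ?thesis
      by (simp add: yz power_add)
  next
    case False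
    obtain a b where ab: "partial_fraction k1 m1 k2 m2 = (a, b)"
      by force
    then have "is_partial_fraction k1 m1 k2 m2 a b"
      using is_partial_fraction_partial_fraction[OF False, of k1 k2] assms yz by (simp add: Y_def)
    then have "1 / ((x + m1) ^ k1 * (x + m2) ^ k2) =
        (\<Sum>i=1..k1. a i / (x + m1) ^ i) + (\<Sum>j=1..k2. b j / (x + m2) ^ j)"
      using assms yz by (simp add: is_partial_fraction_def Y_def)
    from arg_cong[OF this, of "of_rat :: rat \<Rightarrow> complex"] show ?thesis
      using False
      by (simp add: yz ab letter_eval_add letter_eval_sum letter_eval_scale
          of_rat_add of_rat_sum of_rat_divide of_rat_mult of_rat_power)
  qed
qed

lemma letter_eval_letter_mult:
  assumes "p \<in> letter_span" "q \<in> letter_span" "0 < x"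
  shows "letter_eval x (letter_mult p q) = letter_eval x p * letter_eval x q"
proof -
  have "bilinear_map scale scale (*) (\<lambda>p q. letter_eval x (letter_mult p q))"
    by (intro bilinear_mapI Vector_Spaces.linear_compose[unfolded comp_def,
          OF _ linear_letter_eval] linear_intros)
  moreover have "bilinear_map scale scale (*) (\<lambda>p q. letter_eval x p * letter_eval x q)"
    by unfold_locales (simp_all add: letter_eval_add letter_eval_scale algebra_simps)
  ultimately show ?thesis
    by (rule bilinear_map.eq_on_span[where B = "word_elem ` (\<lambda>y. [y]) ` Y"
          and C = "word_elem ` (\<lambda>y. [y]) ` Y"])
      (use assms in \<open>auto simp: letter_span_def letter_eval_letter_prod
          simp del: letter_prod.simps letter_eval_word_elem\<close>)
qed

lemma letter_eval_eq_0_imp_eq_0: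
  assumes p: "p \<in> letter_span" and eval: "\<And>x. 0 < x \<Longrightarrow> letter_eval x p = 0"
  shows "p = 0"
proof -
  have "Poly_Mapping.lookup p w = 0" if w: "w \<in> Poly_Mapping.keys p" for w
  proof (rule inverse_powers_independent[where X = "of_rat ` {0<..}" and k = "\<lambda>w. fst (hd w)"
        and a = "\<lambda>w. - of_rat (snd (hd w))", OF finite_keys _ _ _ _ w])
    show "infinite (of_rat ` {0<..} :: complex set)"
      using infinite_Ioi[of "0 :: rat"] by (simp add: finite_image_iff inj_on_def)
    show "inj_on (\<lambda>w. (fst (hd w), - of_rat (snd (hd w)) :: complex)) (Poly_Mapping.keys p)"
    proof (rule inj_onI)
      fix v w :: word
      assume v: "v \<in> Poly_Mapping.keys p" and w: "w \<in> Poly_Mapping.keys p"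
        and eq: "(fst (hd v), - of_rat (snd (hd v)) :: complex) =
          (fst (hd w), - of_rat (snd (hd w)))"
      obtain y z where "v = [y]" "w = [z]"
        using keys_letter_spanE[OF p v] keys_letter_spanE[OF p w] by metis
      with eq show "v = w"
        by (simp add: prod_eq_iff)
    qed
    show "0 < fst (hd w)" if "w \<in> Poly_Mapping.keys p" for w
      by (rule keys_letter_spanE[OF p that]) (auto simp: Y_def)
    show "(\<Sum>w\<in>Poly_Mapping.keys p.
        Poly_Mapping.lookup p w / (z - - of_rat (snd (hd w))) ^ fst (hd w)) = 0"
      if "z \<in> of_rat ` {0<..}" for z
      using that eval by (auto simp: letter_eval_def of_rat_add)
  qed
  then have "Poly_Mapping.lookup p w = 0" for w
    by (cases "w \<in> Poly_Mapping.keys p") (simp_all add: in_keys_iff)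
  then show ?thesis
    by (intro poly_mapping_eqI) simp
qed

lemma letter_eval_inject:
  assumes "p \<in> letter_span" "q \<in> letter_span"
    and "\<And>x. 0 < x \<Longrightarrow> letter_eval x p = letter_eval x q"
  shows "p = q"
proof -
  have "p - q \<in> letter_span"
    using assms(1,2) by (simp add: letter_span_def words.span_diff)
  then have "p - q = 0"
    using assms(3) by (intro letter_eval_eq_0_imp_eq_0) (simp_all add: letter_eval_diff)
  then show ?thesis
    by simp
qed

lemma letter_mult_commute:
  assumes "p \<in> letter_span" "q \<in> letter_span"
  shows "letter_mult p q = letter_mult q p"
  using assms
  by (intro letter_eval_inject) (simp_all add: letter_mult_in_letter_span letter_eval_letter_mult)

lemma letter_prod_commute:
  assumes "x \<in> Y" "y \<in> Y"
  shows "letter_prod x y = letter_prod y x"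
  using letter_mult_commute[of "word_elem [x]" "word_elem [y]"] assms
  by (simp add: word_elem_in_letter_span)

lemma letter_mult_swap_outer:
  assumes "p \<in> letter_span" "q \<in> letter_span" "r \<in> letter_span"
  shows "letter_mult (letter_mult p q) r = letter_mult (letter_mult r q) p"
  using assms
  by (intro letter_eval_inject) (simp_all add: letter_mult_in_letter_span letter_eval_letter_mult)

section \<open>The stuffle product\<close>

lemma stuffle_word_Nil_right [simp]: "stuffle_word \<mu> u [] = word_elem u"
  by (cases u rule: rev_cases) simp_all

lemma stuffle_word_commute:
  assumes "u \<in> lists Y" "v \<in> lists Y"
  shows "stuffle_word \<mu> u v = stuffle_word \<mu> v u"
  using assms
proof (induction \<mu> u v rule: stuffle_word.induct)
  case (3 \<mu> u x v y)
  then show ?case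
    using letter_prod_commute[of x y] by (simp add: algebra_simps)
qed simp_all

context
  fixes \<mu> :: complex
begin

notation conc (infixl "\<cdot>" 75)

abbreviation (input) stuffle_infix (infixl "\<star>" 70) where
  "p \<star> q \<equiv> stuffle \<mu> p q"

lemma stuffle_conc_conc:
  assumes "a \<in> letter_span" "b \<in> letter_span"
  shows "p \<cdot> a \<star> q \<cdot> b =
    (p \<star> q \<cdot> b) \<cdot> a + (p \<cdot> a \<star> q) \<cdot> b - scale \<mu> ((p \<star> q) \<cdot> letter_mult a b)"
proof -
  let ?rhs = "\<lambda>p q a b. (p \<star> q \<cdot> b) \<cdot> a + (p \<cdot> a \<star> q) \<cdot> b - scale \<mu> ((p \<star> q) \<cdot> letter_mult a b)"
  have words: "word_elem u \<cdot> a \<star> word_elem v \<cdot> b = ?rhs (word_elem u) (word_elem v) a b" for u v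
  proof -
    have "bilinear_map scale scale scale (\<lambda>a b. word_elem u \<cdot> a \<star> word_elem v \<cdot> b)"
      "bilinear_map scale scale scale (?rhs (word_elem u) (word_elem v))"
      by (intro bilinear_mapI linear_intros)+
    then show ?thesis
      using assms unfolding letter_span_def by (rule bilinear_map.eq_on_span) auto
  qed
  have "bilinear_map scale scale scale (\<lambda>p q. p \<cdot> a \<star> q \<cdot> b)"
    "bilinear_map scale scale scale (\<lambda>p q. ?rhs p q a b)"
    by (intro bilinear_mapI linear_intros)+
  moreover have "p \<in> words.span (range word_elem)" "q \<in> words.span (range word_elem)"
    by (simp_all add: span_word_elem)
  ultimately show ?thesis
    by (rule bilinear_map.eq_on_span) (use words in auto)
qed

lemma stuffle_stuffle_conc:
  assumes letters: "a \<in> letter_span" "b \<in> letter_span" "c \<in> letter_span"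
    and pqr: "P = p \<cdot> a" "Q = q \<cdot> b" "R = r \<cdot> c"
  shows "(P \<star> Q) \<star> R =
    ((p \<star> Q) \<star> R) \<cdot> a + ((P \<star> q) \<star> R) \<cdot> b + ((P \<star> Q) \<star> r) \<cdot> c
    - scale \<mu> (((p \<star> q) \<star> R) \<cdot> letter_mult a b)
    - scale \<mu> (((p \<star> Q) \<star> r) \<cdot> letter_mult a c)
    - scale \<mu> (((P \<star> q) \<star> r) \<cdot> letter_mult b c)
    + scale (\<mu> * \<mu>) (((p \<star> q) \<star> r) \<cdot> letter_mult (letter_mult a b) c)"
proof -
  have PQ: "P \<star> Q = (p \<star> Q) \<cdot> a + (P \<star> q) \<cdot> b - scale \<mu> ((p \<star> q) \<cdot> letter_mult a b)"
    unfolding pqr using letters by (intro stuffle_conc_conc)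
  have step: "s \<cdot> d \<star> R = (s \<star> R) \<cdot> d + (s \<cdot> d \<star> r) \<cdot> c - scale \<mu> ((s \<star> r) \<cdot> letter_mult d c)"
    if "d \<in> letter_span" for s d
    unfolding pqr using that letters by (intro stuffle_conc_conc)
  have "((p \<star> Q) \<cdot> a \<star> r) \<cdot> c + ((P \<star> q) \<cdot> b \<star> r) \<cdot> c
      - scale \<mu> (((p \<star> q) \<cdot> letter_mult a b \<star> r) \<cdot> c) = ((P \<star> Q) \<star> r) \<cdot> c"
    unfolding PQ by (simp add: stuffle.left.add stuffle.left.diff stuffle.left.scale
        conc.left.add conc.left.diff conc.left.scale)
  moreover have "(P \<star> Q) \<star> R = (p \<star> Q) \<cdot> a \<star> R + (P \<star> q) \<cdot> b \<star> R
      - scale \<mu> ((p \<star> q) \<cdot> letter_mult a b \<star> R)"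
    unfolding PQ by (simp add: stuffle.left.add stuffle.left.diff stuffle.left.scale)
  ultimately show ?thesis
    by (simp add: step letters letter_mult_in_letter_span algebra_simps)
qed

lemma stuffle_conc_swap_outer:
  assumes letters: "a \<in> letter_span" "b \<in> letter_span" "c \<in> letter_span"
    and pqr: "P = p \<cdot> a" "Q = q \<cdot> b" "R = r \<cdot> c"
    and swap: "(p \<star> Q) \<star> R = (R \<star> Q) \<star> p" "(P \<star> q) \<star> R = (R \<star> q) \<star> P"
      "(P \<star> Q) \<star> r = (r \<star> Q) \<star> P" "(p \<star> q) \<star> R = (R \<star> q) \<star> p"
      "(p \<star> Q) \<star> r = (r \<star> Q) \<star> p" "(P \<star> q) \<star> r = (r \<star> q) \<star> P"
      "(p \<star> q) \<star> r = (r \<star> q) \<star> p"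
  shows "(P \<star> Q) \<star> R = (R \<star> Q) \<star> P"
proof -
  have letter_swap: "letter_mult a b = letter_mult b a" "letter_mult a c = letter_mult c a"
    "letter_mult b c = letter_mult c b"
    "letter_mult (letter_mult a b) c = letter_mult (letter_mult c b) a"
    by (rule letter_mult_commute letter_mult_swap_outer; fact letters)+
  show ?thesis
    unfolding stuffle_stuffle_conc[OF letters pqr]
      stuffle_stuffle_conc[OF letters(3,2,1) pqr(3,2,1)] swap letter_swap(4)
    unfolding letter_swap(1,2,3)
    by simp
qed

lemma stuffle_Nil_left [simp]: "word_elem [] \<star> p = p"
  by (rule words_pair.linear_eq_on[where B = "range word_elem"])
    (auto simp: span_word_elem intro!: linear_intros)

lemma stuffle_Nil_right [simp]: "p \<star> word_elem [] = p"
  by (rule words_pair.linear_eq_on[where B = "range word_elem"])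
    (auto simp: span_word_elem intro!: linear_intros)

lemma stuffle_word_swap_outer:
  assumes "u \<in> lists Y" "v \<in> lists Y" "w \<in> lists Y"
  shows "stuffle_word \<mu> u v \<star> word_elem w = stuffle_word \<mu> w v \<star> word_elem u"
  using assms
proof (induction "length u + length v + length w" arbitrary: u v w rule: less_induct)
  case less
  show ?case
  proof (cases "u = [] \<or> v = [] \<or> w = []")
    case True
    then show ?thesis
      using less.prems by (auto intro: stuffle_word_commute)
  next
    case False
    then obtain u' x v' y w' z where uvw: "u = u' @ [x]" "v = v' @ [y]" "w = w' @ [z]"
      by (metis rev_exhaust)
    have Y: "u' \<in> lists Y" "v' \<in> lists Y" "w' \<in> lists Y" "x \<in> Y" "y \<in> Y" "z \<in> Y"
      using less.prems uvw by auto
    have lengths: "length u = Suc (length u')" "length v = Suc (length v')"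
      "length w = Suc (length w')"
      by (simp_all add: uvw)
    have "(word_elem u \<star> word_elem v) \<star> word_elem w = (word_elem w \<star> word_elem v) \<star> word_elem u"
    proof (rule stuffle_conc_swap_outer)
      show "word_elem u = word_elem u' \<cdot> word_elem [x]" "word_elem v = word_elem v' \<cdot> word_elem [y]"
        "word_elem w = word_elem w' \<cdot> word_elem [z]"
        by (simp_all add: uvw)
    qed (use less.prems Y in \<open>auto simp: lengths intro: word_elem_in_letter_span less.hyps\<close>)
    then show ?thesis
      by simp
  qed
qed

lemma stuffle_commute:
  assumes "Poly_Mapping.keys p \<subseteq> lists Y" "Poly_Mapping.keys q \<subseteq> lists Y"
  shows "p \<star> q = q \<star> p"
proof -
  have "bilinear_map scale scale scale (\<lambda>p q. p \<star> q)" "bilinear_map scale scale scale (\<lambda>p q. q \<star> p)"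
    by (intro bilinear_mapI linear_intros)+
  then show ?thesis
    by (rule bilinear_map.eq_on_span[where B = "word_elem ` lists Y" and C = "word_elem ` lists Y"])
      (use assms in \<open>auto simp: span_word_elem intro: stuffle_word_commute\<close>)
qed

lemma stuffle_swap_outer:
  assumes "Poly_Mapping.keys p \<subseteq> lists Y" "Poly_Mapping.keys q \<subseteq> lists Y"
    "Poly_Mapping.keys r \<subseteq> lists Y"
  shows "(p \<star> q) \<star> r = (r \<star> q) \<star> p"
proof -
  let ?B = "word_elem ` lists Y"
  have "(p \<star> word_elem v) \<star> r = (r \<star> word_elem v) \<star> p" if "v \<in> lists Y" for v
  proof -
    have "bilinear_map scale scale scale (\<lambda>p r. (p \<star> word_elem v) \<star> r)"
      "bilinear_map scale scale scale (\<lambda>p r. (r \<star> word_elem v) \<star> p)"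
      by (intro bilinear_mapI linear_intros)+
    then show ?thesis
      by (rule bilinear_map.eq_on_span[where B = ?B and C = ?B])
        (use assms that in \<open>auto simp: span_word_elem intro: stuffle_word_swap_outer\<close>)
  qed
  then show ?thesis
    by (intro words_pair.linear_eq_on[where x = q and B = ?B and f = "\<lambda>q. (p \<star> q) \<star> r"
          and g = "\<lambda>q. (r \<star> q) \<star> p"] linear_intros)
      (use assms in \<open>auto simp: span_word_elem\<close>)
qed

end

section \<open>The coefficient ring and the free module\<close>

lemma QmuI: "(\<And>i. coeff p i \<in> \<rat>) \<Longrightarrow> poly p \<mu> \<in> Qmu \<mu>"
  unfolding Qmu_def by blast

lemma QmuE:
  assumes "a \<in> Qmu \<mu>"
  obtains p where "a = poly p \<mu>" "\<And>i. coeff p i \<in> \<rat>"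
  using assms unfolding Qmu_def by blast

lemma Qmu_Rats: "a \<in> \<rat> \<Longrightarrow> a \<in> Qmu \<mu>"
  using QmuI[of "[:a:]" \<mu>] by (simp add: coeff_pCons split: nat.split)

lemma Qmu_generator: "\<mu> \<in> Qmu \<mu>"
  using QmuI[of "[:0, 1:]" \<mu>] by (simp add: coeff_pCons split: nat.split)

lemma Qmu_add:
  assumes "a \<in> Qmu \<mu>" "b \<in> Qmu \<mu>"
  shows "a + b \<in> Qmu \<mu>"
proof -
  obtain p q where "a = poly p \<mu>" "\<And>i. coeff p i \<in> \<rat>" "b = poly q \<mu>" "\<And>i. coeff q i \<in> \<rat>"
    using assms by (metis QmuE)
  then show ?thesis
    using QmuI[of "p + q" \<mu>] by simp
qed

lemma Qmu_mult:
  assumes "a \<in> Qmu \<mu>" "b \<in> Qmu \<mu>"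
  shows "a * b \<in> Qmu \<mu>"
proof -
  obtain p q where "a = poly p \<mu>" "\<And>i. coeff p i \<in> \<rat>" "b = poly q \<mu>" "\<And>i. coeff q i \<in> \<rat>"
    using assms by (metis QmuE)
  then show ?thesis
    using QmuI[of "p * q" \<mu>] by (simp add: coeff_mult Rats_sum)
qed

lemma Qmu_uminus: "a \<in> Qmu \<mu> \<Longrightarrow> - a \<in> Qmu \<mu>"
  using Qmu_mult[of "- 1" \<mu> a] by (simp add: Qmu_Rats)

lemma cring_Qmu_ring: "cring (Qmu_ring \<mu>)"
proof (rule cringI)
  show "abelian_group (Qmu_ring \<mu>)"
  proof (rule abelian_groupI)
    fix a assume "a \<in> carrier (Qmu_ring \<mu>)"
    then show "\<exists>b\<in>carrier (Qmu_ring \<mu>). b \<oplus>\<^bsub>Qmu_ring \<mu>\<^esub> a = \<zero>\<^bsub>Qmu_ring \<mu>\<^esub>"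
      using Qmu_uminus[of a \<mu>] by (intro bexI[of _ "- a"]) (simp_all add: Qmu_ring_def)
  qed (simp_all add: Qmu_ring_def Qmu_add Qmu_Rats)
  show "Group.comm_monoid (Qmu_ring \<mu>)"
    by (rule comm_monoidI) (simp_all add: Qmu_ring_def Qmu_mult Qmu_Rats)
qed (simp add: Qmu_ring_def algebra_simps)

lemma QmuY_word_elem: "w \<in> lists Y \<Longrightarrow> word_elem w \<in> QmuY \<mu>"
  by (simp add: QmuY_def word_elem_def lookup_single when_def Qmu_Rats)

lemma QmuY_add: "p \<in> QmuY \<mu> \<Longrightarrow> q \<in> QmuY \<mu> \<Longrightarrow> p + q \<in> QmuY \<mu>"
  using keys_add[of p q] by (simp add: QmuY_def lookup_add Qmu_add) blast

lemma QmuY_scale: "a \<in> Qmu \<mu> \<Longrightarrow> p \<in> QmuY \<mu> \<Longrightarrow> scale a p \<in> QmuY \<mu>"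
  using keys_scale_subset[of a p] by (auto simp: QmuY_def Qmu_mult)

lemma QmuY_zero: "0 \<in> QmuY \<mu>"
  by (simp add: QmuY_def Qmu_Rats)

lemma QmuY_uminus: "p \<in> QmuY \<mu> \<Longrightarrow> - p \<in> QmuY \<mu>"
  by (simp add: QmuY_def Qmu_uminus)

lemma QmuY_diff: "p \<in> QmuY \<mu> \<Longrightarrow> q \<in> QmuY \<mu> \<Longrightarrow> p - q \<in> QmuY \<mu>"
  using QmuY_add[of p \<mu> "- q"] by (simp add: QmuY_uminus)

lemma QmuY_sum: "(\<And>a. a \<in> A \<Longrightarrow> f a \<in> QmuY \<mu>) \<Longrightarrow> sum f A \<in> QmuY \<mu>"
  by (induction A rule: infinite_finite_induct) (simp_all add: QmuY_zero QmuY_add)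

lemma QmuY_bilinear_ext:
  assumes "p \<in> QmuY \<mu>" "q \<in> QmuY \<mu>"
    and "\<And>u v. u \<in> lists Y \<Longrightarrow> v \<in> lists Y \<Longrightarrow> f u v \<in> QmuY \<mu>"
  shows "bilinear_ext f p q \<in> QmuY \<mu>"
  unfolding bilinear_ext_def
  by (intro QmuY_sum QmuY_scale Qmu_mult assms(3))
    (use assms(1,2) in \<open>auto simp: QmuY_def subset_iff\<close>)

lemma QmuY_conc: "p \<in> QmuY \<mu> \<Longrightarrow> q \<in> QmuY \<mu> \<Longrightarrow> conc p q \<in> QmuY \<mu>"
  unfolding conc_def by (rule QmuY_bilinear_ext) (simp_all add: QmuY_word_elem)

lemma QmuY_letter_prod:
  assumes "x \<in> Y" "y \<in> Y"
  shows "letter_prod x y \<in> QmuY \<mu>"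
proof (cases x, cases y)
  fix k1 m1 k2 m2 assume "x = (k1, m1)" "y = (k2, m2)"
  then show ?thesis
    using assms
    by (auto simp: Y_def split: prod.split
        intro!: QmuY_word_elem QmuY_add QmuY_sum QmuY_scale Qmu_Rats)
qed

lemma QmuY_stuffle_word:
  assumes "u \<in> lists Y" "v \<in> lists Y"
  shows "stuffle_word \<mu> u v \<in> QmuY \<mu>"
  using assms
proof (induction \<mu> u v rule: stuffle_word.induct)
  case (3 \<mu> u x v y)
  then show ?case
    by (auto intro!: QmuY_diff QmuY_add QmuY_scale QmuY_conc QmuY_word_elem QmuY_letter_prod
        Qmu_generator)
qed (simp_all add: QmuY_word_elem)

lemma QmuY_stuffle: "p \<in> QmuY \<mu> \<Longrightarrow> q \<in> QmuY \<mu> \<Longrightarrow> stuffle \<mu> p q \<in> QmuY \<mu>"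
  unfolding stuffle_def by (rule QmuY_bilinear_ext) (auto intro: QmuY_stuffle_word)

lemma keys_QmuY: "p \<in> QmuY \<mu> \<Longrightarrow> Poly_Mapping.keys p \<subseteq> lists Y"
  by (simp add: QmuY_def)

lemma stuffle_assoc:
  assumes "p \<in> QmuY \<mu>" "q \<in> QmuY \<mu>" "r \<in> QmuY \<mu>"
  shows "stuffle \<mu> (stuffle \<mu> p q) r = stuffle \<mu> p (stuffle \<mu> q r)"
proof -
  have "stuffle \<mu> (stuffle \<mu> p q) r = stuffle \<mu> (stuffle \<mu> r q) p"
    using assms by (intro stuffle_swap_outer keys_QmuY)
  also have "stuffle \<mu> r q = stuffle \<mu> q r"
    using assms by (intro stuffle_commute keys_QmuY)
  also have "stuffle \<mu> (stuffle \<mu> q r) p = stuffle \<mu> p (stuffle \<mu> q r)"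
    using assms by (intro stuffle_commute keys_QmuY[of _ \<mu>] QmuY_stuffle)
  finally show ?thesis .
qed

lemma cring_stuffle_algebra: "cring (stuffle_algebra \<mu>)"
proof (rule cringI)
  show "abelian_group (stuffle_algebra \<mu>)"
  proof (rule abelian_groupI)
    fix p assume "p \<in> carrier (stuffle_algebra \<mu>)"
    then show "\<exists>q\<in>carrier (stuffle_algebra \<mu>).
        q \<oplus>\<^bsub>stuffle_algebra \<mu>\<^esub> p = \<zero>\<^bsub>stuffle_algebra \<mu>\<^esub>"
      using QmuY_uminus[of p \<mu>] by (intro bexI[of _ "- p"]) (simp_all add: stuffle_algebra_def)
  qed (simp_all add: stuffle_algebra_def QmuY_add QmuY_zero add_ac)
  show "Group.comm_monoid (stuffle_algebra \<mu>)"
    by (rule comm_monoidI)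
      (simp_all add: stuffle_algebra_def QmuY_stuffle QmuY_word_elem stuffle_assoc
        stuffle_commute keys_QmuY)
qed (simp add: stuffle_algebra_def stuffle.left.add)

theorem theorem3p5:
  fixes \<mu> :: complex
  assumes "Re \<mu> > 0"
  shows "algebra (Qmu_ring \<mu>) (stuffle_algebra \<mu>)"
  by (rule algebraI[OF cring_Qmu_ring cring_stuffle_algebra])
    (simp_all add: Qmu_ring_def stuffle_algebra_def QmuY_scale words.scale_left_distrib
      words.scale_right_distrib stuffle.left.scale)

end
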